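(* Within the Wasserstein gradient flow (WGF) framework, the diffusion-model-based missing data imputation approaches (sampling by the generative process driven by the estimated conditional score $\nabla_{\boldsymbol{X}^{(\text{miss})}}\log\hat p(\boldsymbol{X}^{(\text{miss})}\mid\boldsymbol{X}^{(\text{obs})})$) can be viewed as finding the imputed values that maximize the objective $$\mathcal{F}[r]=\mathbb{E}_{r(\boldsymbol{X}^{(\text{miss})})}\big[\log\hat p(\boldsymbol{X}^{(\text{miss})}\mid\boldsymbol{X}^{(\text{obs})})\big]+\psi(\boldsymbol{X}^{(\text{miss})})+\text{const};$$ that is, after a reparametrization of time, the density $r$ of the generative process follows the Wasserstein gradient flow that ascends $\mathcal{F}$ (equivalently, minimizes $-\mathcal{F}$), where $\text{const}$ is a constant and the scalar $\psi(\boldsymbol{X}^{(\text{miss})})$ is determined by the type of SDE underlying the diffusion model: (1) VP-SDE: $\psi(\boldsymbol{X}^{(\text{miss})})=\mathbb{E}_{r(\boldsymbol{X}^{(\text{miss})})}\big\{\tfrac14[\boldsymbol{X}^{(\text{miss})}]^\top[\boldsymbol{X}^{(\text{miss})}]-\tfrac12\log r(\boldsymbol{X}^{(\text{miss})})\big\}$; (2) VE-SDE: $\psi(\boldsymbol{X}^{(\text{miss})})=\mathbb{E}_{r(\boldsymbol{X}^{(\text{miss})})}\big\{-\tfrac12\log r(\boldsymbol{X}^{(\text{miss})})\big\}$; (3) sub-VP-SDE: $\psi(\boldsymbol{X}^{(\text{miss})})=\mathbb{E}_{r(\boldsymbol{X}^{(\text{miss})})}\big\{\tfrac{1}{4\gamma_\tau}[\boldsymbol{X}^{(\text{miss})}]^\top[\boldsymbol{X}^{(\text{miss})}]-\tfrac12\log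 r(\boldsymbol{X}^{(\text{miss})})\big\}$, where $\gamma_\tau:=1-\exp\!\big(-2\int_0^\tau\beta_s\,\mathrm{d}s\big)>0$ is determined by the noise scale $\beta_\tau$, with $0<\beta_1<\beta_2<\dots<\beta_{\mathrm{T}}<1$. Moreover, in these diffusion models the condition $\psi(\boldsymbol{X}^{(\text{miss})})\ge 0$ holds.
   Context: $\boldsymbol{X}^{(\text{obs})}$ denotes the observed entries of the data (fixed) and $\boldsymbol{X}^{(\text{miss})}$ the missing entries, viewed as a random vector with probability density $r(\boldsymbol{X}^{(\text{miss})})$ (the proposal distribution), evolving with time $\tau$. $\hat p(\cdot\mid\boldsymbol{X}^{(\text{obs})})$ is a given (estimated) conditional density. All gradients, divergences and Laplacians below are with respect to $\boldsymbol{X}^{(\text{miss})}$. The missing data imputation (MDI) objective is $\arg\max_{\boldsymbol{X}^{(\text{miss})}}\mathbb{E}_{r}[\log\hat p(\boldsymbol{X}^{(\text{miss})}\mid\boldsymbol{X}^{(\text{obs})})]$. WGF framework: the Wasserstein gradient flow minimizing a functional $\mathcal{F}_{\text{cost}}$ of $r$ is the continuity equation $\partial_\tau r=-\nabla\cdot(r v_\tau)$ with velocity $v_\tau=-\nabla\frac{\delta\mathcal{F}_{\text{cost}}}{\delta r}$, where $\frac{\delta}{\delta r}$ is the first variation. Ascending $\mathcal{F}$ means $\mathcal{F}_{\text{cost}}=-\mathcal{F}$. The functional may depend on $\tau$ through $\gamma_\tau$, in which case the first variation is taken at fixed $\tau$. Generative (reverse) processes, with time running in the generation direction, have density evolution: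 VP-SDE: $\partial_\tau r=-\nabla\cdot\{r\,\beta_\tau[\tfrac12\boldsymbol{X}^{(\text{miss})}+\nabla\log\hat p(\boldsymbol{X}^{(\text{miss})}\mid\boldsymbol{X}^{(\text{obs})})]\}+\tfrac{\beta_\tau}{2}\nabla\cdot\nabla r$, with noise scale $\beta_\tau\in(0,1)$; VE-SDE: $\partial_\tau r=-\nabla\cdot\{r\,\alpha_\tau\nabla\log\hat p(\boldsymbol{X}^{(\text{miss})}\mid\boldsymbol{X}^{(\text{obs})})\}+\tfrac{\alpha_\tau}{2}\nabla\cdot\nabla r$, where $\alpha_\tau>0$ is the rate $\frac{\mathrm{d}\sigma_\tau^2}{\mathrm{d}\tau}$ of the time-varying noise scale $\sigma_\tau^2$; sub-VP-SDE: $\partial_\tau r=-\nabla\cdot\{r\,\beta_\tau[\tfrac12\boldsymbol{X}^{(\text{miss})}+\gamma_\tau\nabla\log\hat p(\boldsymbol{X}^{(\text{miss})}\mid\boldsymbol{X}^{(\text{obs})})]\}+\tfrac{\beta_\tau\gamma_\tau}{2}\nabla\cdot\nabla r$. Reparametrization of time means multiplying the velocity by a positive scalar function of $\tau$. The entropy of $r$ is $\mathbb{H}[r]:=-\int r(\boldsymbol{X}^{(\text{miss})})\log r(\boldsymbol{X}^{(\text{miss})})\,\mathrm{d}\boldsymbol{X}^{(\text{miss})}$; the paper takes it to be non-negative. *)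

theory Defs
  imports "HOL-Analysis.Analysis"
begin

subsection \<open>Vector calculus\<close>

definition grad :: "('a::euclidean_space \<Rightarrow> real) \<Rightarrow> 'a \<Rightarrow> 'a" where
  "grad f x = (THE D. GDERIV f x :> D)"

definition divergence :: "('a::euclidean_space \<Rightarrow> 'a) \<Rightarrow> 'a \<Rightarrow> real" where
  "divergence V x = (\<Sum>b\<in>Basis. frechet_derivative V (at x) b \<bullet> b)"

definition twice_differentiable :: "('a::euclidean_space \<Rightarrow> real) \<Rightarrow> bool" where
  "twice_differentiable f \<longleftrightarrow>
     (\<forall>x. f differentiable (at x)) \<and> (\<forall>x. grad f differentiable (at x))"

subsection \<open>Densities, expectation, entropy\<close>

definition prob_density :: "('a::euclidean_space \<Rightarrow> real) \<Rightarrow> bool" where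
  "prob_density \<rho> \<longleftrightarrow> (\<forall>x. 0 \<le> \<rho> x) \<and> has_bochner_integral lborel \<rho> 1"

definition expect :: "('a::euclidean_space \<Rightarrow> real) \<Rightarrow> ('a \<Rightarrow> real) \<Rightarrow> real" where
  "expect \<rho> f = (LINT x|density lborel (\<lambda>x. ennreal (\<rho> x)). f x)"

definition diff_entropy :: "('a::euclidean_space \<Rightarrow> real) \<Rightarrow> real" where
  "diff_entropy \<rho> = - (LINT x|lborel. \<rho> x * ln (\<rho> x))"

subsection \<open>Wasserstein gradient flows\<close>

text \<open>
  First variation of a functional on densities, as in Santambrogio, Optimal Transport for
  Applied Mathematicians, Definition 7.12: the perturbations are \<open>\<eta> - \<rho>\<close> with \<open>\<eta>\<close> a bounded,
  compactly supported probability density, so that \<open>\<rho> + \<epsilon> (\<eta> - \<rho>)\<close> is again a density for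
  \<open>0 \<le> \<epsilon> \<le> 1\<close>, and the derivative at \<open>\<epsilon> = 0\<close> is one-sided. The function \<open>g\<close> is determined only
  up to an additive constant, which its gradient does not see.
\<close>

definition first_variation ::
  "(('a::euclidean_space \<Rightarrow> real) \<Rightarrow> real) \<Rightarrow> ('a \<Rightarrow> real) \<Rightarrow> ('a \<Rightarrow> real) \<Rightarrow> bool" where
  "first_variation F \<rho> g \<longleftrightarrow>
     (\<forall>\<eta>. prob_density \<eta> \<and> bounded (range \<eta>) \<and> bounded {x. \<eta> x \<noteq> 0} \<longrightarrow>
        integrable lborel (\<lambda>x. g x * (\<eta> x - \<rho> x)) \<and>
        ((\<lambda>\<epsilon>. F (\<lambda>x. \<rho> x + \<epsilon> * (\<eta> x - \<rho> x))) has_real_derivative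
           (LINT x|lborel. g x * (\<eta> x - \<rho> x))) (at_right 0))"

definition wgf_velocity ::
  "(('a::euclidean_space \<Rightarrow> real) \<Rightarrow> real) \<Rightarrow> ('a \<Rightarrow> real) \<Rightarrow> ('a \<Rightarrow> 'a) \<Rightarrow> bool" where
  "wgf_velocity Fcost \<rho> v \<longleftrightarrow>
     (\<exists>g. first_variation Fcost \<rho> g \<and> (\<forall>x. g differentiable (at x)) \<and> v = (\<lambda>x. - grad g x))"

definition continuity_equation ::
  "real set \<Rightarrow> (real \<Rightarrow> 'a::euclidean_space \<Rightarrow> real) \<Rightarrow> (real \<Rightarrow> 'a \<Rightarrow> 'a) \<Rightarrow> bool" where
  "continuity_equation I r v \<longleftrightarrow>
     (\<forall>\<tau>\<in>I. \<forall>x. (\<lambda>y. r \<tau> y *\<^sub>R v \<tau> y) differentiable (at x) \<and>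
        ((\<lambda>t. r t x) has_real_derivative - divergence (\<lambda>y. r \<tau> y *\<^sub>R v \<tau> y) x) (at \<tau> within I))"

text \<open>
  The flow minimising \<open>Fcost\<close>, with its velocity multiplied by the time factor \<open>c\<close>. The
  functional may depend on time; its first variation at time \<open>\<tau>\<close> is that of the frozen
  functional \<open>Fcost \<tau>\<close>.
\<close>

definition reparametrized_wgf ::
  "real set \<Rightarrow> (real \<Rightarrow> real) \<Rightarrow> (real \<Rightarrow> ('a::euclidean_space \<Rightarrow> real) \<Rightarrow> real) \<Rightarrow>
     (real \<Rightarrow> 'a \<Rightarrow> real) \<Rightarrow> bool" where
  "reparametrized_wgf I c Fcost r \<longleftrightarrow>
     (\<exists>v. (\<forall>\<tau>\<in>I. wgf_velocity (Fcost \<tau>) (r \<tau>) (v \<tau>)) \<and>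
          continuity_equation I r (\<lambda>\<tau> x. c \<tau> *\<^sub>R v \<tau> x))"

definition ascends_up_to_time ::
  "real set \<Rightarrow> (real \<Rightarrow> ('a::euclidean_space \<Rightarrow> real) \<Rightarrow> real) \<Rightarrow> (real \<Rightarrow> 'a \<Rightarrow> real) \<Rightarrow> bool" where
  "ascends_up_to_time I F r \<longleftrightarrow>
     (\<exists>c. (\<forall>\<tau>\<in>I. 0 < c \<tau>) \<and> reparametrized_wgf I c (\<lambda>\<tau> \<rho>. - F \<tau> \<rho>) r)"

subsection \<open>Generative processes\<close>

text \<open>In this part \<open>p\<close> stands for the estimated conditional density of the missing entries, with
  the observed entries already inserted.\<close>

definition vp_evolution ::
  "real set \<Rightarrow> (real \<Rightarrow> real) \<Rightarrow> ('a::euclidean_space \<Rightarrow> real) \<Rightarrow> (real \<Rightarrow> 'a \<Rightarrow> real) \<Rightarrow> bool" where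
  "vp_evolution I \<beta> p r \<longleftrightarrow>
     (\<forall>\<tau>\<in>I. \<forall>x. ((\<lambda>t. r t x) has_real_derivative
        - divergence (\<lambda>y. r \<tau> y *\<^sub>R (\<beta> \<tau> *\<^sub>R ((1/2) *\<^sub>R y + grad (\<lambda>z. ln (p z)) y))) x
        + \<beta> \<tau> / 2 * divergence (grad (r \<tau>)) x) (at \<tau> within I))"

definition ve_evolution ::
  "real set \<Rightarrow> (real \<Rightarrow> real) \<Rightarrow> ('a::euclidean_space \<Rightarrow> real) \<Rightarrow> (real \<Rightarrow> 'a \<Rightarrow> real) \<Rightarrow> bool" where
  "ve_evolution I \<alpha> p r \<longleftrightarrow>
     (\<forall>\<tau>\<in>I. \<forall>x. ((\<lambda>t. r t x) has_real_derivative
        - divergence (\<lambda>y. r \<tau> y *\<^sub>R (\<alpha> \<tau> *\<^sub>R grad (\<lambda>z. ln (p z)) y)) x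
        + \<alpha> \<tau> / 2 * divergence (grad (r \<tau>)) x) (at \<tau> within I))"

definition subvp_gamma :: "(real \<Rightarrow> real) \<Rightarrow> real \<Rightarrow> real" where
  "subvp_gamma \<beta> \<tau> = 1 - exp (- 2 * integral {0..\<tau>} \<beta>)"

definition subvp_evolution ::
  "real set \<Rightarrow> (real \<Rightarrow> real) \<Rightarrow> ('a::euclidean_space \<Rightarrow> real) \<Rightarrow> (real \<Rightarrow> 'a \<Rightarrow> real) \<Rightarrow> bool" where
  "subvp_evolution I \<beta> p r \<longleftrightarrow>
     (\<forall>\<tau>\<in>I. \<forall>x. ((\<lambda>t. r t x) has_real_derivative
        - divergence (\<lambda>y. r \<tau> y *\<^sub>R
            (\<beta> \<tau> *\<^sub>R ((1/2) *\<^sub>R y + subvp_gamma \<beta> \<tau> *\<^sub>R grad (\<lambda>z. ln (p z)) y))) x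
        + \<beta> \<tau> * subvp_gamma \<beta> \<tau> / 2 * divergence (grad (r \<tau>)) x) (at \<tau> within I))"

subsection \<open>Objectives\<close>

definition psi_vp :: "('a::euclidean_space \<Rightarrow> real) \<Rightarrow> real" where
  "psi_vp \<rho> = expect \<rho> (\<lambda>x. 1/4 * (x \<bullet> x) - 1/2 * ln (\<rho> x))"

definition psi_ve :: "('a::euclidean_space \<Rightarrow> real) \<Rightarrow> real" where
  "psi_ve \<rho> = expect \<rho> (\<lambda>x. - (1/2) * ln (\<rho> x))"

definition psi_subvp :: "real \<Rightarrow> ('a::euclidean_space \<Rightarrow> real) \<Rightarrow> real" where
  "psi_subvp \<gamma> \<rho> = expect \<rho> (\<lambda>x. 1 / (4 * \<gamma>) * (x \<bullet> x) - 1/2 * ln (\<rho> x))"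

definition objective ::
  "('a::euclidean_space \<Rightarrow> real) \<Rightarrow> (('a \<Rightarrow> real) \<Rightarrow> real) \<Rightarrow> real \<Rightarrow> ('a \<Rightarrow> real) \<Rightarrow> real" where
  "objective p \<psi> C \<rho> = expect \<rho> (\<lambda>x. ln (p x)) + \<psi> \<rho> + C"

end

theory Submission
  imports Defs
begin

text \<open>
  Write \<open>- F \<rho> = 1/2 \<integral> \<rho> ln \<rho> - \<integral> \<rho> (ln p + a \<bar>x\<bar>\<^sup>2) - C\<close> with \<open>a = 1/4\<close>, \<open>0\<close>, \<open>1/(4 \<gamma>)\<close> for the three
  processes. Up to a constant its first variation is \<open>1/2 ln \<rho> - ln p - a \<bar>x\<bar>\<^sup>2\<close>; the only nonlinear
  term is the entropy, where convexity of \<open>s ln s\<close> squeezes the difference quotient between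
  \<open>(ln \<rho> + 1) (\<eta> - \<rho>)\<close> and \<open>\<eta> ln \<eta> - \<rho> ln \<rho>\<close>, so that dominated convergence applies. Since
  \<open>\<rho> \<nabla> ln \<rho> = \<nabla> \<rho>\<close>, the continuity equation of the flow sped up by \<open>c\<close> is the Fokker-Planck equation
  with drift \<open>c (\<nabla> ln p + 2 a x)\<close> and diffusion \<open>c/2\<close>, and \<open>c = \<beta>\<close>, \<open>\<alpha>\<close>, \<open>\<beta> \<gamma>\<close> gives the three
  evolutions. Finally \<open>\<psi>\<close> is half the entropy plus \<open>a\<close> times the second moment.
\<close>

section \<open>Gradients and divergences on Euclidean space\<close>

lemma has_derivative_imp_gderiv:
  fixes f :: "'a::euclidean_space \<Rightarrow> real"
  assumes "(f has_derivative D) (at x)"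
  shows "GDERIV f x :> (\<Sum>b\<in>Basis. D b *\<^sub>R b)"
proof -
  interpret bounded_linear D
    using assms by (rule has_derivative_bounded_linear)
  have "D = (\<lambda>h. h \<bullet> (\<Sum>b\<in>Basis. D b *\<^sub>R b))"
  proof
    fix h
    have "D h = D (\<Sum>b\<in>Basis. (h \<bullet> b) *\<^sub>R b)"
      by (simp add: euclidean_representation)
    then show "D h = h \<bullet> (\<Sum>b\<in>Basis. D b *\<^sub>R b)"
      by (simp add: sum scale inner_sum_right mult.commute)
  qed
  with assms show ?thesis
    by (simp add: gderiv_def)
qed

lemma grad_eq:
  assumes "GDERIV f x :> D"
  shows "grad f x = D"
  unfolding grad_def
proof (rule the_equality)
  fix E assume "GDERIV f x :> E"
  then have "(\<lambda>h. h \<bullet> E) = (\<lambda>h. h \<bullet> D)"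
    using assms unfolding gderiv_def by (rule has_derivative_unique)
  \<comment> \<open>Evaluating both derivatives at the vector \<open>E - D\<close> makes its squared
    norm vanish.\<close>
  then have "(E - D) \<bullet> E = (E - D) \<bullet> D"
    by (rule fun_cong)
  then have "(E - D) \<bullet> (E - D) = 0"
    by (simp only: inner_diff_right diff_self)
  then show "E = D"
    by simp
qed (rule assms)

text \<open>\<open>grad\<close> is a definite description, so it carries information only where a
  gradient exists; the coordinate form of the derivative supplies one.\<close>

lemma gderiv_grad:
  fixes f :: "'a::euclidean_space \<Rightarrow> real"
  assumes "f differentiable (at x)"
  shows "GDERIV f x :> grad f x"
proof -
  obtain D where "(f has_derivative D) (at x)"
    using assms by (auto simp: differentiable_def)
  note D = has_derivative_imp_gderiv[OF this]
  show ?thesis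
    unfolding grad_eq[OF D] by (rule D)
qed

lemma gderiv_imp_differentiable: "GDERIV f x :> D \<Longrightarrow> f differentiable (at x)"
  unfolding gderiv_def differentiable_def by blast

lemma divergence_add:
  assumes "V differentiable (at x)" "W differentiable (at x)"
  shows "divergence (\<lambda>y. V y + W y) x = divergence V x + divergence W x"
proof -
  have "frechet_derivative (\<lambda>y. V y + W y) (at x)
      = (\<lambda>h. frechet_derivative V (at x) h + frechet_derivative W (at x) h)"
    using assms by (intro frechet_derivative_at[symmetric] has_derivative_add)
      (simp_all add: frechet_derivative_works[symmetric])
  then show ?thesis
    by (simp add: divergence_def inner_add_left sum.distrib)
qed

lemma divergence_scaleR:
  assumes "V differentiable (at x)"
  shows "divergence (\<lambda>y. c *\<^sub>R V y) x = c * divergence V x"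
proof -
  have "frechet_derivative (\<lambda>y. c *\<^sub>R V y) (at x) = (\<lambda>h. c *\<^sub>R frechet_derivative V (at x) h)"
    using assms by (intro frechet_derivative_at[symmetric] has_derivative_scaleR_right)
      (simp add: frechet_derivative_works[symmetric])
  then show ?thesis
    by (simp add: divergence_def sum_distrib_left)
qed

lemma expect_eq:
  assumes "\<rho> \<in> borel_measurable borel" "f \<in> borel_measurable borel" "\<And>x. 0 \<le> \<rho> x"
  shows "expect \<rho> f = (LINT x|lborel. \<rho> x * f x)"
  unfolding expect_def using assms by (subst integral_density) auto

section \<open>Convexity of \<open>s ln s\<close>\<close>

text \<open>This is \<open>ln (t / s) \<le> t / s - 1\<close> multiplied by \<open>s\<close>. The
  point \<open>s = 0\<close> is treated apart: there \<open>s * ln s\<close> is 0, which is also its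
  continuous extension.\<close>

lemma xlnx_tangent:
  fixes s t :: real
  assumes "0 \<le> s" "0 < t"
  shows "t * ln t + (ln t + 1) * (s - t) \<le> s * ln s"
proof (cases "s = 0")
  case False
  then have "ln (t / s) \<le> t / s - 1"
    using assms by (intro ln_le_minus_one) auto
  then have "s * ln (t / s) \<le> s * (t / s - 1)"
    using assms by (intro mult_left_mono) auto
  then show ?thesis
    using False assms by (simp add: ln_div algebra_simps)
qed (use assms in \<open>simp add: algebra_simps\<close>)

text \<open>The tangent inequalities at the mixture \<open>m\<close>, taken for \<open>t\<close> and
  \<open>s\<close> and weighted by \<open>1 - \<epsilon>\<close> and \<open>\<epsilon>\<close>, add
  up so that the linear terms cancel. Since \<open>s\<close> may be 0, \<open>\<epsilon> < 1\<close>
  is what keeps \<open>m\<close> positive.\<close>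

lemma xlnx_convex:
  fixes s t \<epsilon> :: real
  assumes "0 \<le> s" "0 < t" "0 \<le> \<epsilon>" "\<epsilon> < 1"
  shows "(t + \<epsilon> * (s - t)) * ln (t + \<epsilon> * (s - t)) \<le> t * ln t + \<epsilon> * (s * ln s - t * ln t)"
proof -
  define m where "m = t + \<epsilon> * (s - t)"
  have m: "m = (1 - \<epsilon>) * t + \<epsilon> * s"
    by (simp add: m_def algebra_simps)
  have "0 < m"
    unfolding m using assms by (intro add_pos_nonneg) auto
  then have "(1 - \<epsilon>) * (m * ln m + (ln m + 1) * (t - m)) + \<epsilon> * (m * ln m + (ln m + 1) * (s - m))
      \<le> (1 - \<epsilon>) * (t * ln t) + \<epsilon> * (s * ln s)"
    using assms by (intro add_mono mult_left_mono xlnx_tangent) auto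
  also have "(1 - \<epsilon>) * (m * ln m + (ln m + 1) * (t - m)) + \<epsilon> * (m * ln m + (ln m + 1) * (s - m))
      = m * ln m + (ln m + 1) * ((1 - \<epsilon>) * t + \<epsilon> * s - m)"
    by (simp add: algebra_simps)
  also have "\<dots> = m * ln m"
    by (simp add: m)
  finally show ?thesis
    unfolding m_def by (simp add: algebra_simps)
qed

text \<open>This pointwise limit of the difference quotients feeds dominated convergence; the free
  set \<open>S\<close> lets it be used along the unit interval.\<close>

lemma xlnx_pointwise_derivative:
  fixes s t :: real
  assumes "0 < t"
  shows "((\<lambda>\<epsilon>. ((t + \<epsilon> * (s - t)) * ln (t + \<epsilon> * (s - t)) - t * ln t) / \<epsilon>)
    \<longlongrightarrow> (ln t + 1) * (s - t)) (at 0 within S)"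
proof -
  have "((\<lambda>\<epsilon>. (t + \<epsilon> * (s - t)) * ln (t + \<epsilon> * (s - t))) has_field_derivative
      (ln t + 1) * (s - t)) (at 0 within S)"
    using assms by (auto intro!: derivative_eq_intros simp: field_simps)
  then show ?thesis
    by (simp add: has_field_derivative_iff)
qed

text \<open>Restricting to the unit interval gives every \<open>\<epsilon>\<close> in the limit the
  bounds that the convexity estimates ask for.\<close>

lemma at_right_0_eq_Ioo: "at_right (0::real) = at 0 within {0<..<1}"
  by (rule at_within_nhd[where S = "{..<1}"]) auto

section \<open>Integrability for bounded, compactly supported competitors\<close>

lemma integrable_bounded_support:
  fixes f :: "'a::euclidean_space \<Rightarrow> real"
  assumes "f \<in> borel_measurable borel" "bounded (range f)" "bounded {x. f x \<noteq> 0}"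
  shows "integrable lborel f"
proof -
  obtain B where B: "\<And>x. norm (f x) \<le> B"
    using assms(2) by (auto simp: bounded_iff)
  obtain R where R: "{x. f x \<noteq> 0} \<subseteq> cball 0 R"
    using assms(3) by (auto simp: bounded_iff subset_eq)
  have "integrable lborel (\<lambda>x. indicator (cball 0 R) x *\<^sub>R f x)"
    by (rule integrableI_bounded_set_indicator[where B = B])
      (use assms(1) B emeasure_lborel_cball_finite in auto)
  also have "(\<lambda>x. indicator (cball 0 R) x *\<^sub>R f x) = f"
    using R by (intro ext) (auto simp: indicator_def)
  finally show ?thesis .
qed

text \<open>\<open>u\<close> may be unbounded on the whole space, but it is bounded on the compact
  closure of the support of \<open>\<eta>\<close>.\<close>

lemma integrable_bounded_support_mult:
  fixes \<eta> u :: "'a::euclidean_space \<Rightarrow> real"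
  assumes [measurable]: "\<eta> \<in> borel_measurable borel"
    and "bounded (range \<eta>)" "bounded {x. \<eta> x \<noteq> 0}" and u: "continuous_on UNIV u"
  shows "integrable lborel (\<lambda>x. \<eta> x * u x)"
proof (rule integrable_bounded_support)
  have [measurable]: "u \<in> borel_measurable borel"
    using u by (rule borel_measurable_continuous_onI)
  show "(\<lambda>x. \<eta> x * u x) \<in> borel_measurable borel"
    by measurable
  obtain B where B: "\<And>x. \<bar>\<eta> x\<bar> \<le> B"
    using assms(2) by (auto simp: bounded_iff)
  have "bounded (u ` closure {x. \<eta> x \<noteq> 0})"
    using assms(3) by (intro compact_imp_bounded compact_continuous_image continuous_on_subset[OF u])
      (auto simp: compact_closure)
  then obtain M where M: "\<And>x. x \<in> closure {x. \<eta> x \<noteq> 0} \<Longrightarrow> \<bar>u x\<bar> \<le> M"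
    by (auto simp: bounded_iff)
  \<comment> \<open>The absolute value guards against a negative \<open>M\<close>, possible when the
    support is empty.\<close>
  have "\<bar>\<eta> x * u x\<bar> \<le> B * \<bar>M\<bar>" for x
  proof (cases "\<eta> x = 0")
    case False
    then have "\<bar>u x\<bar> \<le> \<bar>M\<bar>"
      using M[of x] closure_subset[of "{x. \<eta> x \<noteq> 0}"] by auto
    then show ?thesis
      unfolding abs_mult using B by (intro mult_mono) (auto intro: order_trans[OF abs_ge_zero])
  qed (use B[of x] in auto)
  then show "bounded (range (\<lambda>x. \<eta> x * u x))"
    by (auto simp: bounded_iff)
  show "bounded {x. \<eta> x * u x \<noteq> 0}"
    using assms(3) by (rule bounded_subset) auto
qed

text \<open>\<open>ln \<eta>\<close> can be unbounded where \<open>\<eta>\<close> is small, but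
  \<open>s ln s\<close> lies between \<open>-1\<close> (tangent at 1) and \<open>s * s\<close>, and
  it vanishes with \<open>s\<close>.\<close>

lemma integrable_bounded_support_xlnx:
  fixes \<eta> :: "'a::euclidean_space \<Rightarrow> real"
  assumes [measurable]: "\<eta> \<in> borel_measurable borel"
    and "bounded (range \<eta>)" "bounded {x. \<eta> x \<noteq> 0}" and nonneg: "\<And>x. 0 \<le> \<eta> x"
  shows "integrable lborel (\<lambda>x. \<eta> x * ln (\<eta> x))"
proof (rule integrable_bounded_support)
  show "(\<lambda>x. \<eta> x * ln (\<eta> x)) \<in> borel_measurable borel"
    by measurable
  obtain B where "\<And>x. \<bar>\<eta> x\<bar> \<le> B"
    using assms(2) by (auto simp: bounded_iff)
  then have B: "\<And>x. \<eta> x \<le> B"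
    using abs_le_D1 by blast
  have "\<bar>\<eta> x * ln (\<eta> x)\<bar> \<le> 1 + B * B" for x
  proof (cases "\<eta> x = 0")
    case False
    then have pos: "0 < \<eta> x"
      using nonneg[of x] by simp
    have "\<eta> x * ln (\<eta> x) \<le> \<eta> x * \<eta> x"
      using pos ln_le_minus_one[OF pos] by (intro mult_left_mono) auto
    also have "\<dots> \<le> B * B"
      using B[of x] pos by (intro mult_mono) auto
    finally have "\<eta> x * ln (\<eta> x) \<le> B * B" .
    moreover have "- 1 \<le> \<eta> x * ln (\<eta> x)"
      using xlnx_tangent[of "\<eta> x" 1] pos by simp
    ultimately show ?thesis
      using zero_le_square[of B] by linarith
  qed simp
  then show "bounded (range (\<lambda>x. \<eta> x * ln (\<eta> x)))"
    by (auto simp: bounded_iff)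
  show "bounded {x. \<eta> x * ln (\<eta> x) \<noteq> 0}"
    using assms(3) by (rule bounded_subset) auto
qed

section \<open>Entropy along a segment from a density to a competitor\<close>

locale positive_density =
  fixes \<rho> :: "'a::euclidean_space \<Rightarrow> real"
  assumes density: "prob_density \<rho>" and pos: "0 < \<rho> x"
    and differentiable: "\<rho> differentiable (at x)"
    and entropy_integrable: "integrable lborel (\<lambda>x. \<rho> x * ln (\<rho> x))"
begin

lemma density_integrable: "integrable lborel \<rho>"
  using density by (auto simp: prob_density_def has_bochner_integral_iff)

lemma density_measurable[measurable]: "\<rho> \<in> borel_measurable borel"
  using borel_measurable_integrable[OF density_integrable] by simp

lemma density_continuous: "continuous_on UNIV \<rho>"
  using differentiable by (simp add: continuous_at_imp_continuous_on differentiable_imp_continuous_within)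

context
  fixes \<eta> :: "'a \<Rightarrow> real"
  assumes \<eta>: "prob_density \<eta>" "bounded (range \<eta>)" "bounded {x. \<eta> x \<noteq> 0}"
begin

definition mixture where "mixture \<epsilon> x = \<rho> x + \<epsilon> * (\<eta> x - \<rho> x)"

lemma competitor_nonneg: "0 \<le> \<eta> x"
  using \<eta>(1) by (simp add: prob_density_def)

lemma competitor_measurable[measurable]: "\<eta> \<in> borel_measurable borel"
  using \<eta>(1) borel_measurable_integrable[of lborel \<eta>]
  by (simp add: prob_density_def has_bochner_integral_iff)

text \<open>The \<open>\<eta>\<close> part is integrable by compact support and continuity of
  \<open>u\<close>, the \<open>\<rho>\<close> part by assumption.\<close>

lemma competitor_mult_integrable:
  "continuous_on UNIV u \<Longrightarrow> integrable lborel (\<lambda>x. \<rho> x * u x) \<Longrightarrow>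
    integrable lborel (\<lambda>x. u x * (\<eta> x - \<rho> x))"
  using integrable_bounded_support_mult[OF competitor_measurable \<eta>(2,3)]
  by (simp add: right_diff_distrib mult.commute[of "u _"])

lemma entropy_bounds_integrable:
  "integrable lborel (\<lambda>x. (ln (\<rho> x) + 1) * (\<eta> x - \<rho> x))"
  "integrable lborel (\<lambda>x. \<eta> x * ln (\<eta> x) - \<rho> x * ln (\<rho> x))"
proof -
  have "continuous_on UNIV (\<lambda>x. ln (\<rho> x) + 1)"
    using pos by (intro continuous_intros density_continuous) (auto simp: less_imp_neq[symmetric])
  moreover have "integrable lborel (\<lambda>x. \<rho> x * (ln (\<rho> x) + 1))"
    using entropy_integrable density_integrable by (simp add: distrib_left)
  ultimately show "integrable lborel (\<lambda>x. (ln (\<rho> x) + 1) * (\<eta> x - \<rho> x))"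
    by (rule competitor_mult_integrable)
  show "integrable lborel (\<lambda>x. \<eta> x * ln (\<eta> x) - \<rho> x * ln (\<rho> x))"
    using integrable_bounded_support_xlnx[OF competitor_measurable \<eta>(2,3) competitor_nonneg]
      entropy_integrable by simp
qed

text \<open>The tangent at \<open>\<rho> x\<close> bounds the quotient from below, convexity along
  the segment from above. Neither bound depends on \<open>\<epsilon>\<close>, as domination
  requires.\<close>

lemma entropy_quotient_bounds:
  assumes "0 < \<epsilon>" "\<epsilon> < 1"
  defines "q x \<equiv> (mixture \<epsilon> x * ln (mixture \<epsilon> x) - \<rho> x * ln (\<rho> x)) / \<epsilon>"
  shows "(ln (\<rho> x) + 1) * (\<eta> x - \<rho> x) \<le> q x"
    and "q x \<le> \<eta> x * ln (\<eta> x) - \<rho> x * ln (\<rho> x)"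
    and "0 \<le> mixture \<epsilon> x"
proof -
  have "mixture \<epsilon> x = (1 - \<epsilon>) * \<rho> x + \<epsilon> * \<eta> x"
    by (simp add: mixture_def algebra_simps)
  then show nn: "0 \<le> mixture \<epsilon> x"
    using assms pos[of x] competitor_nonneg[of x] by simp
  show "(ln (\<rho> x) + 1) * (\<eta> x - \<rho> x) \<le> q x"
    using xlnx_tangent[OF nn pos[of x]] assms
    by (simp add: q_def pos_le_divide_eq mixture_def mult_ac)
  show "q x \<le> \<eta> x * ln (\<eta> x) - \<rho> x * ln (\<rho> x)"
    using xlnx_convex[OF competitor_nonneg[of x] pos[of x], of \<epsilon>] assms
    by (simp add: q_def pos_divide_le_eq mixture_def mult_ac)
qed

text \<open>A quantity between two bounds is at most the sum of their absolute values in
  modulus.\<close>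

definition entropy_dominating where
  "entropy_dominating x =
    \<bar>(ln (\<rho> x) + 1) * (\<eta> x - \<rho> x)\<bar> + \<bar>\<eta> x * ln (\<eta> x) - \<rho> x * ln (\<rho> x)\<bar>"

lemma entropy_dominating_integrable: "integrable lborel entropy_dominating"
  unfolding entropy_dominating_def
  by (intro Bochner_Integration.integrable_add Bochner_Integration.integrable_abs entropy_bounds_integrable)

lemma norm_entropy_quotient_le:
  assumes "0 < \<epsilon>" "\<epsilon> < 1"
  shows "norm ((mixture \<epsilon> x * ln (mixture \<epsilon> x) - \<rho> x * ln (\<rho> x)) / \<epsilon>) \<le> \<bar>entropy_dominating x\<bar>"
  using entropy_quotient_bounds[OF assms, of x]
  unfolding real_norm_def entropy_dominating_def by linarith

lemma entropy_mixture_integrable: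
  assumes "0 < \<epsilon>" "\<epsilon> < 1"
  shows "integrable lborel (\<lambda>x. mixture \<epsilon> x * ln (mixture \<epsilon> x))"
proof -
  have [measurable]: "mixture \<epsilon> \<in> borel_measurable borel"
    unfolding mixture_def by measurable
  have "integrable lborel (\<lambda>x. (mixture \<epsilon> x * ln (mixture \<epsilon> x) - \<rho> x * ln (\<rho> x)) / \<epsilon>)"
  proof (rule Bochner_Integration.integrable_bound[OF entropy_dominating_integrable])
    show "AE x in lborel. norm ((mixture \<epsilon> x * ln (mixture \<epsilon> x) - \<rho> x * ln (\<rho> x)) / \<epsilon>)
        \<le> norm (entropy_dominating x)"
      using norm_entropy_quotient_le[OF assms] by simp
  qed measurable
  \<comment> \<open>The quotient is integrable by domination; undoing the division and the
    subtraction recovers the mixture's own entropy integrand.\<close>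
  then have "integrable lborel
      (\<lambda>x. \<epsilon> * ((mixture \<epsilon> x * ln (mixture \<epsilon> x) - \<rho> x * ln (\<rho> x)) / \<epsilon>) + \<rho> x * ln (\<rho> x))"
    using entropy_integrable by (intro Bochner_Integration.integrable_add integrable_mult_right) auto
  then show ?thesis
    using assms by simp
qed

lemma entropy_quotient_tendsto:
  "((\<lambda>\<epsilon>. LINT x|lborel. (mixture \<epsilon> x * ln (mixture \<epsilon> x) - \<rho> x * ln (\<rho> x)) / \<epsilon>)
    \<longlongrightarrow> (LINT x|lborel. (ln (\<rho> x) + 1) * (\<eta> x - \<rho> x))) (at_right 0)"
  \<comment> \<open>Dominated convergence is applied to sequences, so the limit is tested along
    sequences in the unit interval.\<close>
  unfolding at_right_0_eq_Ioo tendsto_at_iff_sequentially comp_def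
proof (intro allI impI)
  fix X :: "nat \<Rightarrow> real"
  assume X: "\<forall>i. X i \<in> {0<..<1} - {0}" "X \<longlonglongrightarrow> 0"
  have [measurable]: "mixture \<epsilon> \<in> borel_measurable borel" for \<epsilon>
    unfolding mixture_def by measurable
  show "(\<lambda>i. LINT x|lborel. (mixture (X i) x * ln (mixture (X i) x) - \<rho> x * ln (\<rho> x)) / X i)
      \<longlonglongrightarrow> (LINT x|lborel. (ln (\<rho> x) + 1) * (\<eta> x - \<rho> x))"
  proof (rule integral_dominated_convergence)
    show "integrable lborel (\<lambda>x. \<bar>entropy_dominating x\<bar>)"
      by (intro Bochner_Integration.integrable_abs entropy_dominating_integrable)
    show "AE x in lborel. norm ((mixture (X i) x * ln (mixture (X i) x) - \<rho> x * ln (\<rho> x)) / X i)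
        \<le> \<bar>entropy_dominating x\<bar>" for i
      using X(1) by (intro AE_I2 norm_entropy_quotient_le) auto
    show "AE x in lborel. (\<lambda>i. (mixture (X i) x * ln (mixture (X i) x) - \<rho> x * ln (\<rho> x)) / X i)
        \<longlonglongrightarrow> (ln (\<rho> x) + 1) * (\<eta> x - \<rho> x)"
      using xlnx_pointwise_derivative[OF pos, where S = "{0<..<1}"] X
      unfolding mixture_def tendsto_at_iff_sequentially comp_def by (intro AE_I2) blast
  qed measurable
qed

end

section \<open>First variation of the objective and the sign of its extra term\<close>

text \<open>Differentiating \<open>1/2 * s * ln s\<close> also yields a constant \<open>1/2\<close>;
  it is dropped from the variation because \<open>\<eta> - \<rho>\<close> integrates to 0.\<close>

lemma first_variation_objective:
  assumes p: "continuous_on UNIV (\<lambda>x. ln (p x))"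
    and cross_entropy: "integrable lborel (\<lambda>x. \<rho> x * ln (p x))"
    and moment: "integrable lborel (\<lambda>x. \<rho> x * (a * (x \<bullet> x)))"
  shows "first_variation
    (\<lambda>\<rho>. - objective p (\<lambda>\<rho>. expect \<rho> (\<lambda>x. a * (x \<bullet> x) - 1/2 * ln (\<rho> x))) C \<rho>) \<rho>
    (\<lambda>x. 1/2 * ln (\<rho> x) - (ln (p x) + a * (x \<bullet> x)))"
  unfolding first_variation_def
proof (intro allI impI conjI; elim conjE)
  fix \<eta> :: "'a \<Rightarrow> real"
  assume \<eta>: "prob_density \<eta>" "bounded (range \<eta>)" "bounded {x. \<eta> x \<noteq> 0}"
  define u where "u x = ln (p x) + a * (x \<bullet> x)" for x
  define m where "m = mixture \<eta>"
  have [measurable]: "m \<epsilon> \<in> borel_measurable borel" for \<epsilon>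
    using competitor_measurable[OF \<eta>] unfolding m_def mixture_def[OF \<eta>] by measurable
  have quadratic: "continuous_on UNIV (\<lambda>x::'a. a * (x \<bullet> x))"
    by (intro continuous_intros)
  have u: "continuous_on UNIV u" "integrable lborel (\<lambda>x. \<rho> x * u x)"
    unfolding u_def distrib_left using p cross_entropy moment by (auto intro!: continuous_intros)
  note du = competitor_mult_integrable[OF \<eta> u]
  note ds = entropy_bounds_integrable(1)[OF \<eta>]
  have d1: "integrable lborel (\<lambda>x. \<eta> x - \<rho> x)" "(LINT x|lborel. \<eta> x - \<rho> x) = 0"
    using density \<eta>(1) by (auto simp: prob_density_def has_bochner_integral_iff)
  \<comment> \<open>The last summand is that surplus constant, removed by \<open>d1\<close> after
    integration.\<close>
  have variation_eq: "(1/2 * ln (\<rho> x) - u x) * (\<eta> x - \<rho> x)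
      = 1/2 * ((ln (\<rho> x) + 1) * (\<eta> x - \<rho> x)) - u x * (\<eta> x - \<rho> x) - 1/2 * (\<eta> x - \<rho> x)" for x
    by (simp add: field_simps)
  show "integrable lborel (\<lambda>x. (1/2 * ln (\<rho> x) - (ln (p x) + a * (x \<bullet> x))) * (\<eta> x - \<rho> x))"
    unfolding u_def[symmetric] variation_eq using du ds d1(1) by simp
  have variation: "(LINT x|lborel. (1/2 * ln (\<rho> x) - u x) * (\<eta> x - \<rho> x))
      = 1/2 * (LINT x|lborel. (ln (\<rho> x) + 1) * (\<eta> x - \<rho> x)) - (LINT x|lborel. u x * (\<eta> x - \<rho> x))"
    unfolding variation_eq using du ds d1 by simp
  define G where "G \<epsilon> = - objective p (\<lambda>\<rho>. expect \<rho> (\<lambda>x. a * (x \<bullet> x) - 1/2 * ln (\<rho> x))) C (m \<epsilon>)" for \<epsilon>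
  have m_integrable: "integrable lborel (\<lambda>x. m \<epsilon> x * f x)"
    if "continuous_on UNIV f" "integrable lborel (\<lambda>x. \<rho> x * f x)" for f \<epsilon>
  proof -
    have "integrable lborel (\<lambda>x. \<rho> x * f x + \<epsilon> * (f x * (\<eta> x - \<rho> x)))"
      using that competitor_mult_integrable[OF \<eta> that] by simp
    then show ?thesis
      unfolding m_def mixture_def[OF \<eta>] by (simp add: algebra_simps)
  qed
  \<comment> \<open>Apart from the entropy, \<open>G\<close> is affine in \<open>\<epsilon>\<close>.
    The value \<open>\<epsilon> = 0\<close> is included as the base point of the quotient and
    checked separately below, since the entropy lemmas assume \<open>0 < \<epsilon>\<close>.\<close>
  have G: "G \<epsilon> = 1/2 * (LINT x|lborel. m \<epsilon> x * ln (m \<epsilon> x))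
      - (LINT x|lborel. \<rho> x * u x) - \<epsilon> * (LINT x|lborel. u x * (\<eta> x - \<rho> x)) - C"
    if "0 \<le> \<epsilon>" "\<epsilon> < 1" for \<epsilon>
  proof -
    have nonneg: "0 \<le> m \<epsilon> x" for x
      using entropy_quotient_bounds(3)[OF \<eta>, of \<epsilon> x] that less_imp_le[OF pos[of x]]
      by (cases "\<epsilon> = 0") (auto simp: m_def mixture_def[OF \<eta>])
    have ent: "integrable lborel (\<lambda>x. m \<epsilon> x * ln (m \<epsilon> x))"
      using entropy_mixture_integrable[OF \<eta>, of \<epsilon>] that entropy_integrable
      by (cases "\<epsilon> = 0") (auto simp: m_def mixture_def[OF \<eta>])
    have [measurable]: "(\<lambda>x. ln (p x)) \<in> borel_measurable borel"
      using p by (rule borel_measurable_continuous_onI)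
    have "- G \<epsilon> = (LINT x|lborel. m \<epsilon> x * ln (p x))
        + (LINT x|lborel. m \<epsilon> x * (a * (x \<bullet> x) - 1/2 * ln (m \<epsilon> x))) + C"
      unfolding G_def objective_def using nonneg by (subst (1 2) expect_eq) auto
    also have "(LINT x|lborel. m \<epsilon> x * (a * (x \<bullet> x) - 1/2 * ln (m \<epsilon> x)))
        = (LINT x|lborel. m \<epsilon> x * (a * (x \<bullet> x)) - 1/2 * (m \<epsilon> x * ln (m \<epsilon> x)))"
      by (simp add: algebra_simps)
    also have "\<dots> = (LINT x|lborel. m \<epsilon> x * (a * (x \<bullet> x))) - 1/2 * (LINT x|lborel. m \<epsilon> x * ln (m \<epsilon> x))"
      using m_integrable[OF quadratic moment] ent by simp
    finally have "- G \<epsilon> = (LINT x|lborel. m \<epsilon> x * ln (p x)) + (LINT x|lborel. m \<epsilon> x * (a * (x \<bullet> x)))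
        - 1/2 * (LINT x|lborel. m \<epsilon> x * ln (m \<epsilon> x)) + C"
      by simp
    moreover have "(LINT x|lborel. m \<epsilon> x * ln (p x)) + (LINT x|lborel. m \<epsilon> x * (a * (x \<bullet> x)))
        = (LINT x|lborel. m \<epsilon> x * u x)"
      unfolding u_def distrib_left
      using m_integrable[OF quadratic moment] m_integrable[OF p cross_entropy] by simp
    moreover have "(LINT x|lborel. m \<epsilon> x * u x)
        = (LINT x|lborel. \<rho> x * u x + \<epsilon> * (u x * (\<eta> x - \<rho> x)))"
      unfolding m_def mixture_def[OF \<eta>] by (simp add: algebra_simps)
    moreover have "\<dots> = (LINT x|lborel. \<rho> x * u x) + \<epsilon> * (LINT x|lborel. u x * (\<eta> x - \<rho> x))"
      using u du by simp
    ultimately show ?thesis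
      by linarith
  qed
  have quotient: "(G \<epsilon> - G 0) / (\<epsilon> - 0)
      = 1/2 * (LINT x|lborel. (m \<epsilon> x * ln (m \<epsilon> x) - \<rho> x * ln (\<rho> x)) / \<epsilon>) - (LINT x|lborel. u x * (\<eta> x - \<rho> x))"
    if "0 < \<epsilon>" "\<epsilon> < 1" for \<epsilon>
  proof -
    have "m 0 = \<rho>"
      by (simp add: m_def mixture_def[OF \<eta>] fun_eq_iff)
    moreover have "integrable lborel (\<lambda>x. m \<epsilon> x * ln (m \<epsilon> x))"
      using entropy_mixture_integrable[OF \<eta> that] by (simp add: m_def)
    ultimately show ?thesis
      using that entropy_integrable by (simp add: G field_simps)
  qed
  have "((\<lambda>\<epsilon>. (G \<epsilon> - G 0) / (\<epsilon> - 0))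
      \<longlongrightarrow> (LINT x|lborel. (1/2 * ln (\<rho> x) - u x) * (\<eta> x - \<rho> x))) (at_right 0)"
    unfolding variation
  proof (rule Lim_transform_eventually)
    show "((\<lambda>\<epsilon>. 1/2 * (LINT x|lborel. (m \<epsilon> x * ln (m \<epsilon> x) - \<rho> x * ln (\<rho> x)) / \<epsilon>)
        - (LINT x|lborel. u x * (\<eta> x - \<rho> x)))
      \<longlongrightarrow> 1/2 * (LINT x|lborel. (ln (\<rho> x) + 1) * (\<eta> x - \<rho> x)) - (LINT x|lborel. u x * (\<eta> x - \<rho> x)))
      (at_right 0)"
      unfolding m_def by (intro tendsto_intros entropy_quotient_tendsto[OF \<eta>])
    show "\<forall>\<^sub>F \<epsilon> in at_right 0. 1/2 * (LINT x|lborel. (m \<epsilon> x * ln (m \<epsilon> x) - \<rho> x * ln (\<rho> x)) / \<epsilon>)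
        - (LINT x|lborel. u x * (\<eta> x - \<rho> x)) = (G \<epsilon> - G 0) / (\<epsilon> - 0)"
      unfolding at_right_0_eq_Ioo eventually_at_filter using quotient by (intro always_eventually) auto
  qed
  then show "((\<lambda>\<epsilon>. - objective p (\<lambda>\<rho>. expect \<rho> (\<lambda>x. a * (x \<bullet> x) - 1/2 * ln (\<rho> x))) C
        (\<lambda>x. \<rho> x + \<epsilon> * (\<eta> x - \<rho> x))) has_real_derivative
      (LINT x|lborel. (1/2 * ln (\<rho> x) - (ln (p x) + a * (x \<bullet> x))) * (\<eta> x - \<rho> x))) (at_right 0)"
    unfolding has_field_derivative_iff G_def u_def m_def mixture_def[OF \<eta>] .
qed

text \<open>Nonnegative entropy is a premise because a differential entropy can be negative; the
  quadratic part is nonnegative by itself.\<close>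

lemma expect_quadratic_minus_ln_nonneg:
  assumes "0 \<le> a" "integrable lborel (\<lambda>x. \<rho> x * (a * (x \<bullet> x)))" "0 \<le> diff_entropy \<rho>"
  shows "0 \<le> expect \<rho> (\<lambda>x. a * (x \<bullet> x) - 1/2 * ln (\<rho> x))"
proof -
  have "expect \<rho> (\<lambda>x. a * (x \<bullet> x) - 1/2 * ln (\<rho> x))
      = (LINT x|lborel. \<rho> x * (a * (x \<bullet> x)) - 1/2 * (\<rho> x * ln (\<rho> x)))"
    using less_imp_le[OF pos] by (subst expect_eq) (auto simp: algebra_simps)
  also have "\<dots> = (LINT x|lborel. \<rho> x * (a * (x \<bullet> x))) + 1/2 * diff_entropy \<rho>"
    using assms(2) entropy_integrable by (simp add: diff_entropy_def)
  also have "0 \<le> \<dots>"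
    using assms less_imp_le[OF pos] by (intro add_nonneg_nonneg integral_nonneg) auto
  finally show ?thesis .
qed

end

section \<open>From a Fokker-Planck equation to a gradient flow\<close>

text \<open>One statement for all three processes. The coefficients \<open>a\<close> and
  \<open>c\<close> vary with time; the drift contains \<open>2 * a \<tau>\<close> because that is
  the factor in the gradient of \<open>a \<tau> * (x \<bullet> x)\<close>.\<close>

lemma ascends_up_to_time_objective:
  fixes r :: "real \<Rightarrow> 'a::euclidean_space \<Rightarrow> real"
  assumes r: "\<And>\<tau>. \<tau> \<in> I \<Longrightarrow> positive_density (r \<tau>)"
    and r2: "\<And>\<tau>. \<tau> \<in> I \<Longrightarrow> twice_differentiable (r \<tau>)"
    and p2: "twice_differentiable (\<lambda>x. ln (p x))"
    and cross_entropy: "\<And>\<tau>. \<tau> \<in> I \<Longrightarrow> integrable lborel (\<lambda>x. r \<tau> x * ln (p x))"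
    and moment: "\<And>\<tau>. \<tau> \<in> I \<Longrightarrow> integrable lborel (\<lambda>x. r \<tau> x * (a \<tau> * (x \<bullet> x)))"
    and c: "\<And>\<tau>. \<tau> \<in> I \<Longrightarrow> 0 < c \<tau>"
    and evolution: "\<And>\<tau> x. \<tau> \<in> I \<Longrightarrow> ((\<lambda>t. r t x) has_real_derivative
      - divergence (\<lambda>y. r \<tau> y *\<^sub>R (c \<tau> *\<^sub>R ((2 * a \<tau>) *\<^sub>R y + grad (\<lambda>z. ln (p z)) y))) x
      + c \<tau> / 2 * divergence (grad (r \<tau>)) x) (at \<tau> within I)"
  shows "ascends_up_to_time I
    (\<lambda>\<tau>. objective p (\<lambda>\<rho>. expect \<rho> (\<lambda>x. a \<tau> * (x \<bullet> x) - 1/2 * ln (\<rho> x))) C) r"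
proof -
  define g where "g \<tau> x = 1/2 * ln (r \<tau> x) - (ln (p x) + a \<tau> * (x \<bullet> x))" for \<tau> x
  define w where "w \<tau> y = r \<tau> y *\<^sub>R (c \<tau> *\<^sub>R ((2 * a \<tau>) *\<^sub>R y + grad (\<lambda>z. ln (p z)) y))" for \<tau> y
  have g: "GDERIV (g \<tau>) x :> (1 / (2 * r \<tau> x)) *\<^sub>R grad (r \<tau>) x
      - (grad (\<lambda>z. ln (p z)) x + (2 * a \<tau>) *\<^sub>R x)" if \<tau>: "\<tau> \<in> I" for \<tau> x
  proof -
    have "GDERIV (\<lambda>x. 1/2 * ln (r \<tau> x)) x :> (1 / (2 * r \<tau> x)) *\<^sub>R grad (r \<tau>) x"
    proof (rule GDERIV_DERIV_compose[where g = "\<lambda>s. 1/2 * ln s"])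
      show "GDERIV (r \<tau>) x :> grad (r \<tau>) x"
        using r2[OF \<tau>] by (intro gderiv_grad) (simp add: twice_differentiable_def)
      show "((\<lambda>s. 1/2 * ln s) has_real_derivative 1 / (2 * r \<tau> x)) (at (r \<tau> x))"
        using positive_density.pos[OF r[OF \<tau>], of x]
        by (auto intro!: derivative_eq_intros simp: field_simps)
    qed
    moreover have "GDERIV (\<lambda>z. ln (p z)) x :> grad (\<lambda>z. ln (p z)) x"
      using p2 by (intro gderiv_grad) (simp add: twice_differentiable_def)
    moreover have "GDERIV (\<lambda>x. a \<tau> * (x \<bullet> x)) x :> (2 * a \<tau>) *\<^sub>R x"
      unfolding gderiv_def
      by (auto intro!: derivative_eq_intros simp: inner_commute algebra_simps)
    ultimately show ?thesis
      unfolding g_def by (intro GDERIV_diff GDERIV_add)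
  qed
  have w: "w \<tau> differentiable (at x)" if "\<tau> \<in> I" for \<tau> x
    unfolding w_def using r2[OF that] p2 by (simp add: twice_differentiable_def)
  \<comment> \<open>The prefactor \<open>r\<close> cancels the \<open>1 / r\<close> from the
    gradient of the logarithm, so the entropy contributes a multiple of \<open>grad r\<close>, whose
    divergence is the diffusion term.\<close>
  have flux: "(\<lambda>y. r \<tau> y *\<^sub>R (c \<tau> *\<^sub>R - grad (g \<tau>) y))
      = (\<lambda>y. w \<tau> y + (- (c \<tau> / 2)) *\<^sub>R grad (r \<tau>) y)" if \<tau>: "\<tau> \<in> I" for \<tau>
  proof
    fix y
    have "r \<tau> y \<noteq> 0"
      using positive_density.pos[OF r[OF \<tau>], of y] by simp
    then show "r \<tau> y *\<^sub>R (c \<tau> *\<^sub>R - grad (g \<tau>) y) = w \<tau> y + (- (c \<tau> / 2)) *\<^sub>R grad (r \<tau>) y"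
      unfolding grad_eq[OF g[OF \<tau>]] w_def by (simp add: algebra_simps)
  qed
  have "wgf_velocity (\<lambda>\<rho>. - objective p (\<lambda>\<rho>. expect \<rho> (\<lambda>x. a \<tau> * (x \<bullet> x) - 1/2 * ln (\<rho> x))) C \<rho>)
      (r \<tau>) (\<lambda>x. - grad (g \<tau>) x)" if \<tau>: "\<tau> \<in> I" for \<tau>
    unfolding wgf_velocity_def
  proof (intro exI conjI allI)
    show "first_variation (\<lambda>\<rho>. - objective p (\<lambda>\<rho>. expect \<rho> (\<lambda>x. a \<tau> * (x \<bullet> x) - 1/2 * ln (\<rho> x))) C \<rho>)
        (r \<tau>) (g \<tau>)"
      unfolding g_def
    proof (rule positive_density.first_variation_objective)
      show "continuous_on UNIV (\<lambda>x. ln (p x))"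
        using p2 by (simp add: twice_differentiable_def continuous_at_imp_continuous_on
            differentiable_imp_continuous_within)
    qed (use r cross_entropy moment \<tau> in auto)
    show "g \<tau> differentiable (at x)" for x
      using g[OF \<tau>] by (rule gderiv_imp_differentiable)
  qed simp
  moreover have "continuity_equation I r (\<lambda>\<tau> x. c \<tau> *\<^sub>R - grad (g \<tau>) x)"
    unfolding continuity_equation_def
  proof (intro ballI allI)
    fix \<tau> x assume \<tau>: "\<tau> \<in> I"
    have grad_r: "grad (r \<tau>) differentiable (at x)"
      using r2[OF \<tau>] by (simp add: twice_differentiable_def)
    \<comment> \<open>The divergence may be split only because both parts of the flux are
      differentiable.\<close>
    have scaled: "(\<lambda>y. (- (c \<tau> / 2)) *\<^sub>R grad (r \<tau>) y) differentiable (at x)"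
      using grad_r by (intro differentiable_scaleR) auto
    have divergence_flux: "- divergence (\<lambda>y. w \<tau> y + (- (c \<tau> / 2)) *\<^sub>R grad (r \<tau>) y) x
        = - divergence (w \<tau>) x + c \<tau> / 2 * divergence (grad (r \<tau>)) x"
      unfolding divergence_add[OF w[OF \<tau>] scaled] divergence_scaleR[OF grad_r] by simp
    have "((\<lambda>t. r t x) has_real_derivative
        - divergence (w \<tau>) x + c \<tau> / 2 * divergence (grad (r \<tau>)) x) (at \<tau> within I)"
      unfolding w_def[abs_def] by (rule evolution[OF \<tau>])
    then show "(\<lambda>y. r \<tau> y *\<^sub>R c \<tau> *\<^sub>R - grad (g \<tau>) y) differentiable at x \<and>
        ((\<lambda>t. r t x) has_real_derivative - divergence (\<lambda>y. r \<tau> y *\<^sub>R c \<tau> *\<^sub>R - grad (g \<tau>) y) x)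
          (at \<tau> within I)"
      unfolding flux[OF \<tau>] divergence_flux by (intro conjI differentiable_add w[OF \<tau>] scaled)
  qed
  ultimately show ?thesis
    unfolding ascends_up_to_time_def reparametrized_wgf_def
    by (intro exI[where x = c] exI[where x = "\<lambda>\<tau> x. - grad (g \<tau>) x"] conjI ballI c)
qed

section \<open>Positivity of integrals of positive functions\<close>

text \<open>A nonnegative function with zero Lebesgue integral vanishes almost everywhere, but here
  it is positive on an interval of positive measure. Only interior points count, which suits a noise
  scale not controlled at time 0.\<close>

lemma integral_pos_of_pos:
  fixes f :: "real \<Rightarrow> real"
  assumes "a < b" "f integrable_on {a..b}" and pos: "\<And>x. x \<in> {a<..<b} \<Longrightarrow> 0 < f x"
  shows "0 < integral {a..b} f"
proof -
  have "f integrable_on {a<..<b}"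
    using assms(2) by (simp add: integrable_on_open_interval_real)
  \<comment> \<open>The sign of \<open>f\<close> upgrades gauge integrability to Lebesgue
    integrability.\<close>
  then have abs_int: "f absolutely_integrable_on {a<..<b}"
    using pos by (intro nonnegative_absolutely_integrable_1) (auto intro: less_imp_le)
  let ?f = "\<lambda>x. indicator {a<..<b} x *\<^sub>R f x"
  have int: "integrable lebesgue ?f" and nonneg: "AE x in lebesgue. 0 \<le> ?f x"
    using abs_int pos by (auto simp: set_integrable_def indicator_def intro!: AE_I2 less_imp_le)
  have "integral {a..b} f = integral\<^sup>L lebesgue ?f"
    using set_lebesgue_integral_eq_integral(2)[OF abs_int]
    by (simp add: set_lebesgue_integral_def integral_open_interval_real)
  moreover have "0 \<le> integral\<^sup>L lebesgue ?f"
    using nonneg by (rule integral_nonneg_AE)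
  moreover have "integral\<^sup>L lebesgue ?f \<noteq> 0"
  proof
    assume "integral\<^sup>L lebesgue ?f = 0"
    then have "AE x in lebesgue. ?f x = 0"
      using integral_nonneg_eq_0_iff_AE[OF int nonneg] by simp
    then have "AE x in lebesgue. x \<notin> {a<..<b}"
      by eventually_elim (use pos in \<open>force simp: indicator_def split: if_splits\<close>)
    then have "emeasure lebesgue {a<..<b} = 0"
      by (subst (asm) AE_iff_measurable[where N = "{a<..<b}"]) auto
    with \<open>a < b\<close> show False
      by simp
  qed
  ultimately show ?thesis
    by simp
qed

section \<open>The three generative processes as gradient flows\<close>

theorem proposition3p1:
  fixes phat :: "'o \<Rightarrow> 'a::euclidean_space \<Rightarrow> real"
    and xobs :: 'o
    and r :: "real \<Rightarrow> 'a \<Rightarrow> real"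
    and T C :: real
  assumes "0 < T"
    and "prob_density (phat xobs)"
    and "\<And>x. 0 < phat xobs x"
    and "twice_differentiable (\<lambda>x. ln (phat xobs x))"
    and "\<And>\<tau>. \<tau> \<in> {0<..T} \<Longrightarrow> prob_density (r \<tau>)"
    and "\<And>\<tau> x. \<tau> \<in> {0<..T} \<Longrightarrow> 0 < r \<tau> x"
    and "\<And>\<tau>. \<tau> \<in> {0<..T} \<Longrightarrow> twice_differentiable (r \<tau>)"
    and "\<And>\<tau>. \<tau> \<in> {0<..T} \<Longrightarrow> integrable lborel (\<lambda>x. r \<tau> x * ln (phat xobs x))"
    and "\<And>\<tau>. \<tau> \<in> {0<..T} \<Longrightarrow> integrable lborel (\<lambda>x. r \<tau> x * ln (r \<tau> x))"
  shows
    "(\<forall>\<beta>.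
        (\<forall>\<tau>\<in>{0<..T}. 0 < \<beta> \<tau> \<and> \<beta> \<tau> < 1) \<and>
        vp_evolution {0<..T} \<beta> (phat xobs) r \<and>
        (\<forall>\<tau>\<in>{0<..T}. integrable lborel (\<lambda>x. r \<tau> x * (x \<bullet> x)))
        \<longrightarrow> ascends_up_to_time {0<..T} (\<lambda>\<tau>. objective (phat xobs) psi_vp C) r \<and>
            (\<forall>\<tau>\<in>{0<..T}. 0 \<le> diff_entropy (r \<tau>) \<longrightarrow> 0 \<le> psi_vp (r \<tau>)))
     \<and>
     (\<forall>\<sigma> \<alpha>.
        (\<forall>\<tau>\<in>{0<..T}. ((\<lambda>s. (\<sigma> s)\<^sup>2) has_real_derivative \<alpha> \<tau>) (at \<tau> within {0<..T}) \<and> 0 < \<alpha> \<tau>) \<and>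
        ve_evolution {0<..T} \<alpha> (phat xobs) r
        \<longrightarrow> ascends_up_to_time {0<..T} (\<lambda>\<tau>. objective (phat xobs) psi_ve C) r \<and>
            (\<forall>\<tau>\<in>{0<..T}. 0 \<le> diff_entropy (r \<tau>) \<longrightarrow> 0 \<le> psi_ve (r \<tau>)))
     \<and>
     (\<forall>\<beta>.
        (\<forall>\<tau>\<in>{0<..T}. 0 < \<beta> \<tau> \<and> \<beta> \<tau> < 1) \<and>
        (\<forall>(i::nat) (j::nat). 1 \<le> i \<and> i < j \<and> real j \<le> T \<longrightarrow> \<beta> (real i) < \<beta> (real j)) \<and>
        \<beta> integrable_on {0..T} \<and>
        subvp_evolution {0<..T} \<beta> (phat xobs) r \<and>
        (\<forall>\<tau>\<in>{0<..T}. integrable lborel (\<lambda>x. r \<tau> x * (x \<bullet> x)))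
        \<longrightarrow> (\<forall>\<tau>\<in>{0<..T}. 0 < subvp_gamma \<beta> \<tau>) \<and>
            ascends_up_to_time {0<..T}
              (\<lambda>\<tau>. objective (phat xobs) (psi_subvp (subvp_gamma \<beta> \<tau>)) C) r \<and>
            (\<forall>\<tau>\<in>{0<..T}. 0 \<le> diff_entropy (r \<tau>) \<longrightarrow> 0 \<le> psi_subvp (subvp_gamma \<beta> \<tau>) (r \<tau>)))"
proof -
  have r: "positive_density (r \<tau>)" if "\<tau> \<in> {0<..T}" for \<tau>
    using assms(5-7,9)[OF that] by unfold_locales (auto simp: twice_differentiable_def)
  note ascends = ascends_up_to_time_objective[where C = C, OF r assms(7) assms(4) assms(8)]
  note nonneg = positive_density.expect_quadratic_minus_ln_nonneg[OF r]
  have moment: "integrable lborel (\<lambda>x. r \<tau> x * (a * (x \<bullet> x)))"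
    if "integrable lborel (\<lambda>x. r \<tau> x * (x \<bullet> x))" for a \<tau>
    using integrable_mult_right[OF that, of a] by (simp add: mult_ac)
  show ?thesis
  proof (intro conjI allI impI; elim conjE)
    fix \<beta> assume \<beta>: "\<forall>\<tau>\<in>{0<..T}. 0 < \<beta> \<tau> \<and> \<beta> \<tau> < 1"
      and ev: "vp_evolution {0<..T} \<beta> (phat xobs) r"
      and second_moment: "\<forall>\<tau>\<in>{0<..T}. integrable lborel (\<lambda>x. r \<tau> x * (x \<bullet> x))"
    \<comment> \<open>VP is the case \<open>a = 1/4\<close>, \<open>c = \<beta>\<close>; the drift
      coefficient \<open>1/2\<close> is \<open>2 * a\<close>.\<close>
    have psi: "psi_vp = (\<lambda>\<rho> :: 'a \<Rightarrow> real. expect \<rho> (\<lambda>x. 1/4 * (x \<bullet> x) - 1/2 * ln (\<rho> x)))"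
      by (simp add: psi_vp_def fun_eq_iff)
    show "ascends_up_to_time {0<..T} (\<lambda>\<tau>. objective (phat xobs) psi_vp C) r"
      unfolding psi
    proof (rule ascends)
      show "0 < \<beta> \<tau>" if "\<tau> \<in> {0<..T}" for \<tau>
        using \<beta> that by blast
    qed (use ev second_moment moment in \<open>auto simp: vp_evolution_def\<close>)
    show "\<forall>\<tau>\<in>{0<..T}. 0 \<le> diff_entropy (r \<tau>) \<longrightarrow> 0 \<le> psi_vp (r \<tau>)"
      unfolding psi by (intro ballI impI nonneg moment) (use second_moment in auto)
  next
    fix \<sigma> \<alpha> :: "real \<Rightarrow> real"
    assume \<alpha>: "\<forall>\<tau>\<in>{0<..T}. ((\<lambda>s. (\<sigma> s)\<^sup>2) has_real_derivative \<alpha> \<tau>) (at \<tau> within {0<..T}) \<and> 0 < \<alpha> \<tau>"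
      and ev: "ve_evolution {0<..T} \<alpha> (phat xobs) r"
    \<comment> \<open>A zero quadratic term is inserted to match the general form; with
      \<open>a = 0\<close> the moment condition is trivial.\<close>
    have psi: "psi_ve = (\<lambda>\<rho> :: 'a \<Rightarrow> real. expect \<rho> (\<lambda>x. 0 * (x \<bullet> x) - 1/2 * ln (\<rho> x)))"
      by (simp add: psi_ve_def fun_eq_iff)
    show "ascends_up_to_time {0<..T} (\<lambda>\<tau>. objective (phat xobs) psi_ve C) r"
      unfolding psi
    proof (rule ascends)
      show "0 < \<alpha> \<tau>" if "\<tau> \<in> {0<..T}" for \<tau>
        using \<alpha> that by blast
    qed (use ev in \<open>auto simp: ve_evolution_def\<close>)
    show "\<forall>\<tau>\<in>{0<..T}. 0 \<le> diff_entropy (r \<tau>) \<longrightarrow> 0 \<le> psi_ve (r \<tau>)"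
      unfolding psi using nonneg[where a = 0] by auto
  next
    fix \<beta> assume \<beta>: "\<forall>\<tau>\<in>{0<..T}. 0 < \<beta> \<tau> \<and> \<beta> \<tau> < 1" "\<beta> integrable_on {0..T}"
      and ev: "subvp_evolution {0<..T} \<beta> (phat xobs) r"
      and second_moment: "\<forall>\<tau>\<in>{0<..T}. integrable lborel (\<lambda>x. r \<tau> x * (x \<bullet> x))"
    show gamma: "\<forall>\<tau>\<in>{0<..T}. 0 < subvp_gamma \<beta> \<tau>"
    proof
      fix \<tau> assume \<tau>: "\<tau> \<in> {0<..T}"
      \<comment> \<open>A positive integral puts the exponential in \<open>subvp_gamma\<close> below
        1.\<close>
      have "0 < integral {0..\<tau>} \<beta>"
        using \<tau> \<beta> by (intro integral_pos_of_pos integrable_on_subinterval[OF \<beta>(2)]) auto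
      then show "0 < subvp_gamma \<beta> \<tau>"
        by (simp add: subvp_gamma_def)
    qed
    have psi: "psi_subvp \<gamma> = (\<lambda>\<rho> :: 'a \<Rightarrow> real. expect \<rho> (\<lambda>x. 1 / (4 * \<gamma>) * (x \<bullet> x) - 1/2 * ln (\<rho> x)))" for \<gamma>
      by (simp add: psi_subvp_def fun_eq_iff)
    show "ascends_up_to_time {0<..T}
        (\<lambda>\<tau>. objective (phat xobs) (psi_subvp (subvp_gamma \<beta> \<tau>)) C) r"
      unfolding psi
    proof (rule ascends)
      fix \<tau> assume \<tau>: "\<tau> \<in> {0<..T}"
      then have \<gamma>: "0 < subvp_gamma \<beta> \<tau>"
        using gamma by blast
      show "0 < \<beta> \<tau> * subvp_gamma \<beta> \<tau>"
        using \<beta> \<tau> \<gamma> by simp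
      show "integrable lborel (\<lambda>x. r \<tau> x * (1 / (4 * subvp_gamma \<beta> \<tau>) * (x \<bullet> x)))"
        using moment second_moment \<tau> by blast
      \<comment> \<open>With \<open>c = \<beta> * \<gamma>\<close> and
        \<open>a = 1 / (4 * \<gamma>)\<close>, the factor \<open>\<gamma>\<close> cancels in the
        linear drift and stays on the score; this uses that \<open>\<gamma>\<close> is
        nonzero.\<close>
      have drift: "(\<beta> \<tau> * subvp_gamma \<beta> \<tau>) *\<^sub>R ((2 * (1 / (4 * subvp_gamma \<beta> \<tau>))) *\<^sub>R y + z)
          = \<beta> \<tau> *\<^sub>R ((1/2) *\<^sub>R y + subvp_gamma \<beta> \<tau> *\<^sub>R z)" for y z :: 'a
        using \<gamma> by (simp add: scaleR_add_right)
      show "((\<lambda>t. r t x) has_real_derivative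
          - divergence (\<lambda>y. r \<tau> y *\<^sub>R ((\<beta> \<tau> * subvp_gamma \<beta> \<tau>) *\<^sub>R
              ((2 * (1 / (4 * subvp_gamma \<beta> \<tau>))) *\<^sub>R y + grad (\<lambda>z. ln (phat xobs z)) y))) x
          + \<beta> \<tau> * subvp_gamma \<beta> \<tau> / 2 * divergence (grad (r \<tau>)) x) (at \<tau> within {0<..T})" for x
        unfolding drift using ev \<tau> by (simp add: subvp_evolution_def)
    qed
    show "\<forall>\<tau>\<in>{0<..T}. 0 \<le> diff_entropy (r \<tau>) \<longrightarrow> 0 \<le> psi_subvp (subvp_gamma \<beta> \<tau>) (r \<tau>)"
      unfolding psi by (intro ballI impI nonneg moment) (use second_moment gamma in \<open>auto intro: less_imp_le\<close>)
  qed
qed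

end
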